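(* Let $X,Y$ be Hilbert spaces, $A\colon X\to Y$ a bounded linear operator, and $\Phi\colon X\to X$ a Lipschitz continuous map with $\Phi(X)\subseteq\ker(A)$. Put $\mathcal M:=(\mathrm{Id}_X+\Phi)(\operatorname{ran}(A^+))$. Suppose $((B_\alpha)_{\alpha>0},\alpha^\star)$ is any classical regularization method for the equation $Ax=y$. Then the pair $((R_\alpha)_{\alpha>0},\alpha^\star)$ with $R_\alpha:=(\mathrm{Id}_X+\Phi)\circ B_\alpha$ is an $\mathcal M$-regularization method for $Ax=y$. In particular, the family $(R_\alpha)_{\alpha>0}$ is a regularization of $A^{\mathcal M}$.
   Context: $A^+\colon\operatorname{dom}(A^+)\subseteq Y\to X$ denotes the Moore-Penrose generalized inverse of $A$, with $\operatorname{dom}(A^+)=\operatorname{ran}(A)\oplus\operatorname{ran}(A)^\perp$; $A^+y$ is the minimal norm solution of $A^*Ax=A^*y$, and $\operatorname{ran}(A^+)=\ker(A)^\perp$. The $\mathcal M$-generalized inverse of $A$ (for $\mathcal M=(\mathrm{Id}_X+\Phi)(\operatorname{ran}(A^+))$) is the map $A^{\mathcal M}\colon\operatorname{dom}(A^+)\to X$, $A^{\mathcal M}y:=(\mathrm{Id}_X+\Phi)(A^+y)$. $\mathcal M$-regularization method: let $(R_\alpha)_{\alpha>0}$ be a family of continuous (not necessarily linear) maps $R_\alpha\colon Y\to X$ and let $\alpha^\star\colon(0,\infty)\times Y\to(0,\infty)$. The pair $((R_\alpha)_{\alpha>0},\alpha^\star)$ is an $\mathcal M$-regularization method for $Ax=y$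 if (i) for all $y\in Y$: $\lim_{\delta\to0}\sup\{\alpha^\star(\delta,y^\delta)\mid y^\delta\in Y,\ \|y^\delta-y\|\le\delta\}=0$; and (ii) for all $y\in\operatorname{dom}(A^+)$: $\lim_{\delta\to0}\sup\{\|A^{\mathcal M}y-R_{\alpha^\star(\delta,y^\delta)}(y^\delta)\|\mid y^\delta\in Y,\ \|y^\delta-y\|\le\delta\}=0$. In that case $(R_\alpha)_{\alpha>0}$ is called a regularization of $A^{\mathcal M}$ and $\alpha^\star$ an admissible parameter choice. Thus $(R_\alpha)_{\alpha>0}$ is a regularization of $A^{\mathcal M}$ if some $\alpha^\star$ makes the pair an $\mathcal M$-regularization method. A classical regularization method is the special case $\Phi=0$, i.e. a $\operatorname{ran}(A^+)$-regularization method, where $A^{\mathcal M}=A^+$. *)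

theory Defs
  imports "HOL-Analysis.Analysis"
begin

text \<open>
  Hilbert spaces are types of sort \<open>{real_inner, complete_space}\<close>. A complex Hilbert space
  with the inner product \<open>Re \<langle>x, y\<rangle>\<close> is of this kind, and for a complex-linear operator
  this change leaves the norm, kernel, range, its orthogonal complement and the adjoint unchanged.

  Maps defined only on a subset are total functions whose values off that subset are irrelevant:
  \<open>mp_inverse A\<close> and \<open>gen_inverse A \<Phi>\<close> matter only on \<open>mp_dom A\<close>, families \<open>R\<close> only at
  indices \<open>a > 0\<close>, and parameter choices only at \<open>\<delta> > 0\<close>.
\<close>

definition mp_dom :: "('a::real_vector \<Rightarrow> 'b::real_inner) \<Rightarrow> 'b set" where
  "mp_dom A = {u + v | u v. u \<in> range A \<and> v \<in> (range A)\<^sup>\<bottom>}"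

text \<open>
  On Hilbert spaces and for bounded linear \<open>A\<close>, the adjoint exists and is unique by the Riesz
  representation theorem, and for \<open>y\<close> in \<open>mp_dom A\<close> the minimiser exists and is unique, so the
  choice operators behind \<open>adjoint\<close> and \<open>ARG_MIN\<close> leave no freedom.
\<close>

definition mp_inverse :: "('a::real_inner \<Rightarrow> 'b::real_inner) \<Rightarrow> 'b \<Rightarrow> 'a" where
  "mp_inverse A y = (ARG_MIN norm x. adjoint A (A x) = adjoint A y)"

definition solution_set :: "('a::real_inner \<Rightarrow> 'b::real_inner) \<Rightarrow> ('a \<Rightarrow> 'a) \<Rightarrow> 'a set" where
  "solution_set A \<Phi> = (\<lambda>x. x + \<Phi> x) ` (mp_inverse A ` mp_dom A)"

text \<open>
  The set \<open>\<M>\<close> is \<open>solution_set A \<Phi>\<close>. Since \<open>A\<^sup>\<M>\<close> is given through \<open>\<Phi>\<close>, the following notions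
  take \<open>\<Phi>\<close> instead of \<open>\<M>\<close> as their parameter.
\<close>

definition gen_inverse ::
    "('a::real_inner \<Rightarrow> 'b::real_inner) \<Rightarrow> ('a \<Rightarrow> 'a) \<Rightarrow> 'b \<Rightarrow> 'a" where
  "gen_inverse A \<Phi> y = mp_inverse A y + \<Phi> (mp_inverse A y)"

lemma gen_inverse_image: "gen_inverse A \<Phi> ` mp_dom A = solution_set A \<Phi>"
  by (simp add: gen_inverse_def solution_set_def image_image)

text \<open>The suprema are taken in \<open>ereal\<close>, so that an unbounded set has supremum \<open>\<infinity>\<close>.\<close>

definition regularization_method ::
    "('a::real_inner \<Rightarrow> 'b::real_inner) \<Rightarrow> ('a \<Rightarrow> 'a) \<Rightarrow> (real \<Rightarrow> 'b \<Rightarrow> 'a)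
      \<Rightarrow> (real \<Rightarrow> 'b \<Rightarrow> real) \<Rightarrow> bool" where
  "regularization_method A \<Phi> R \<alpha> \<longleftrightarrow>
     (\<forall>a>0. continuous_on UNIV (R a)) \<and>
     (\<forall>\<delta>>0. \<forall>y. \<alpha> \<delta> y > 0) \<and>
     (\<forall>y. ((\<lambda>\<delta>. SUP yd\<in>{yd. norm (yd - y) \<le> \<delta>}. ereal (\<alpha> \<delta> yd))
             \<longlongrightarrow> 0) (at_right 0)) \<and>
     (\<forall>y\<in>mp_dom A.
        ((\<lambda>\<delta>. SUP yd\<in>{yd. norm (yd - y) \<le> \<delta>}.
                ereal (norm (gen_inverse A \<Phi> y - R (\<alpha> \<delta> yd) yd)))
             \<longlongrightarrow> 0) (at_right 0))"

definition regularization ::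
    "('a::real_inner \<Rightarrow> 'b::real_inner) \<Rightarrow> ('a \<Rightarrow> 'a) \<Rightarrow> (real \<Rightarrow> 'b \<Rightarrow> 'a) \<Rightarrow> bool" where
  "regularization A \<Phi> R \<longleftrightarrow> (\<exists>\<alpha>. regularization_method A \<Phi> R \<alpha>)"

definition classical_regularization_method ::
    "('a::real_inner \<Rightarrow> 'b::real_inner) \<Rightarrow> (real \<Rightarrow> 'b \<Rightarrow> 'a) \<Rightarrow> (real \<Rightarrow> 'b \<Rightarrow> real) \<Rightarrow> bool" where
  "classical_regularization_method A B \<alpha> \<longleftrightarrow> regularization_method A (\<lambda>_. 0) B \<alpha>"

end

theory Submission
  imports Defs
begin

text \<open>Write T for the map Id + \<Phi>. Both the target \<open>gen_inverse A \<Phi> y\<close>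
  and the reconstruction are images under T: of the Moore-Penrose solution and of the classical
  reconstruction. If \<Phi> is L-Lipschitz, then T is (1 + L)-Lipschitz, so each new error is at
  most 1 + L times the classical error for the same data. The factor does not depend on the data, so
  the bound passes to the worst-case errors, and \<open>tendsto_SUP_ereal_0_mono\<close> turns this
  into convergence. Continuity survives composition with T, and the condition that \<alpha> vanishes
  in the limit does not mention the reconstructions at all.\<close>

text \<open>A squeeze between 0 and C times the supremum of \<open>f\<close>. The suprema live in
  \<open>ereal\<close>, so no boundedness of the families is required.\<close>

lemma tendsto_SUP_ereal_0_mono:
  fixes f g :: "'b \<Rightarrow> 'a \<Rightarrow> real" and S :: "'b \<Rightarrow> 'a set"
  assumes "((\<lambda>t. SUP x\<in>S t. ereal (f t x)) \<longlongrightarrow> 0) F"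
    and "\<forall>\<^sub>F t in F. S t \<noteq> {}"
    and bounds: "\<And>t x. 0 \<le> g t x" "\<And>t x. g t x \<le> C * f t x" and "0 \<le> C"
  shows "((\<lambda>t. SUP x\<in>S t. ereal (g t x)) \<longlongrightarrow> 0) F"
proof (rule tendsto_sandwich)
  \<comment> \<open>Nonemptiness matters here: in \<open>ereal\<close> the supremum over the empty
    set is -\<infinity>, which would break the lower bound.\<close>
  show "\<forall>\<^sub>F t in F. 0 \<le> (SUP x\<in>S t. ereal (g t x))"
    using assms(2)
  proof eventually_elim
    case (elim t)
    then obtain x where "x \<in> S t" by blast
    then show ?case
      using bounds(1) by (intro SUP_upper2[of x]) auto
  qed
  show "\<forall>\<^sub>F t in F. (SUP x\<in>S t. ereal (g t x)) \<le> ereal C * (SUP x\<in>S t. ereal (f t x))"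
  proof (intro always_eventually allI SUP_least)
    fix t x
    assume "x \<in> S t"
    then have "ereal C * ereal (f t x) \<le> ereal C * (SUP x\<in>S t. ereal (f t x))"
      using \<open>0 \<le> C\<close> by (intro ereal_mult_left_mono SUP_upper) auto
    moreover have "ereal (g t x) \<le> ereal C * ereal (f t x)"
      using bounds(2) by simp
    ultimately show "ereal (g t x) \<le> ereal C * (SUP x\<in>S t. ereal (f t x))"
      by (rule order_trans[rotated])
  qed
  \<comment> \<open>Multiplication by the finite constant \<open>ereal C\<close> preserves the
    limit, and C * 0 = 0.\<close>
  show "((\<lambda>t. ereal C * (SUP x\<in>S t. ereal (f t x))) \<longlongrightarrow> 0) F"
    using tendsto_cmult_ereal[OF _ assms(1), of "ereal C"] by simp
qed simp

theorem theorem2p4: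
  fixes A :: "'a::{real_inner, complete_space} \<Rightarrow> 'b::{real_inner, complete_space}"
    and \<Phi> :: "'a \<Rightarrow> 'a"
    and B :: "real \<Rightarrow> 'b \<Rightarrow> 'a"
    and \<alpha> :: "real \<Rightarrow> 'b \<Rightarrow> real"
  assumes "bounded_linear A"
    and "\<exists>L. L-lipschitz_on UNIV \<Phi>"
    and "range \<Phi> \<subseteq> {x. A x = 0}"
    and "classical_regularization_method A B \<alpha>"
  shows "regularization_method A \<Phi> (\<lambda>a. (\<lambda>x. x + \<Phi> x) \<circ> B a) \<alpha> \<and>
    regularization A \<Phi> (\<lambda>a. (\<lambda>x. x + \<Phi> x) \<circ> B a)"
proof -
  obtain L where "L-lipschitz_on UNIV \<Phi>"
    using assms(2) by blast
  \<comment> \<open>The identity contributes 1 and \<Phi> contributes L.\<close>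
  then have lip: "(1 + L)-lipschitz_on UNIV (\<lambda>x. x + \<Phi> x)"
    by (intro lipschitz_on_add lipschitz_on_id)
  have classical: "regularization_method A (\<lambda>_. 0) B \<alpha>"
    using assms(4) by (simp add: classical_regularization_method_def)
  have "((\<lambda>\<delta>. SUP yd\<in>{yd. norm (yd - y) \<le> \<delta>}.
      ereal (norm (gen_inverse A \<Phi> y - ((\<lambda>x. x + \<Phi> x) \<circ> B (\<alpha> \<delta> yd)) yd))) \<longlongrightarrow> 0) (at_right 0)"
    if "y \<in> mp_dom A" for y
  proof (rule tendsto_SUP_ereal_0_mono)
    show "((\<lambda>\<delta>. SUP yd\<in>{yd. norm (yd - y) \<le> \<delta>}.
        ereal (norm (mp_inverse A y - B (\<alpha> \<delta> yd) yd))) \<longlongrightarrow> 0) (at_right 0)"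
      using classical that by (simp add: regularization_method_def gen_inverse_def)
    \<comment> \<open>For \<delta> > 0 the ball contains its centre \<open>y\<close>; for negative
      \<delta> it is empty, hence only an eventual claim.\<close>
    show "\<forall>\<^sub>F \<delta> in at_right 0. {yd. norm (yd - y) \<le> \<delta>} \<noteq> {}"
      using eventually_at_right_less[of 0]
      by eventually_elim (auto intro!: exI[of _ y])
    \<comment> \<open>The Lipschitz estimate for Id + \<Phi> at the exact solution and the classical
      reconstruction; this fixes the constant C as 1 + L.\<close>
    show "norm (gen_inverse A \<Phi> y - ((\<lambda>x. x + \<Phi> x) \<circ> B (\<alpha> \<delta> yd)) yd)
        \<le> (1 + L) * norm (mp_inverse A y - B (\<alpha> \<delta> yd) yd)" for \<delta> yd
      using lipschitz_onD[OF lip, of "mp_inverse A y" "B (\<alpha> \<delta> yd) yd"]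
      by (simp add: gen_inverse_def dist_norm)
    show "0 \<le> 1 + L"
      using lip by (rule lipschitz_on_nonneg)
  qed simp
  moreover have "continuous_on UNIV ((\<lambda>x. x + \<Phi> x) \<circ> B a)" if "a > 0" for a
  proof (rule continuous_on_compose)
    show "continuous_on UNIV (B a)"
      using classical that by (simp add: regularization_method_def)
    show "continuous_on (range (B a)) (\<lambda>x. x + \<Phi> x)"
      using lipschitz_on_continuous_on[OF lip] by (rule continuous_on_subset) simp
  qed
  \<comment> \<open>Positivity of \<alpha> and its convergence to 0 are taken over verbatim from the
    classical method.\<close>
  ultimately have "regularization_method A \<Phi> (\<lambda>a. (\<lambda>x. x + \<Phi> x) \<circ> B a) \<alpha>"
    using classical by (simp add: regularization_method_def)
  then show ?thesis
    unfolding regularization_def by blast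
qed

end
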